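(* Let $R$ be a ring and let $M$ be a distributive $R$-module of finite length. Then $M$ has only finitely many submodules.
   Context: Rings are associative with unity (not necessarily commutative); modules are left modules. A module $M$ is called distributive if its lattice of submodules (with meet given by intersection and join given by sum) is a distributive lattice. *)

theory Defs
  imports "HOL-Algebra.Module" "HOL-Algebra.AbelCoset"
begin

text \<open>
  The library's locale \<open>module\<close> requires a commutative ring of scalars. The following locale has
  the same axioms over an arbitrary ring with unity; it reuses the library's \<open>module\<close> record,
  whose ring multiplication and unit on the module side play no role. The library's
  predicate \<open>submodule\<close> does not assume commutativity of the scalars and is used as it stands.
\<close>

locale left_module = R?: ring R + M?: abelian_group M
  for R (structure) and M (structure) +
  assumes smult_closed:
      "\<lbrakk>a \<in> carrier R; x \<in> carrier M\<rbrakk> \<Longrightarrow> a \<odot>\<^bsub>M\<^esub> x \<in> carrier M"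
    and smult_l_distr:
      "\<lbrakk>a \<in> carrier R; b \<in> carrier R; x \<in> carrier M\<rbrakk> \<Longrightarrow>
       (a \<oplus> b) \<odot>\<^bsub>M\<^esub> x = a \<odot>\<^bsub>M\<^esub> x \<oplus>\<^bsub>M\<^esub> b \<odot>\<^bsub>M\<^esub> x"
    and smult_r_distr:
      "\<lbrakk>a \<in> carrier R; x \<in> carrier M; y \<in> carrier M\<rbrakk> \<Longrightarrow>
       a \<odot>\<^bsub>M\<^esub> (x \<oplus>\<^bsub>M\<^esub> y) = a \<odot>\<^bsub>M\<^esub> x \<oplus>\<^bsub>M\<^esub> a \<odot>\<^bsub>M\<^esub> y"
    and smult_assoc1:
      "\<lbrakk>a \<in> carrier R; b \<in> carrier R; x \<in> carrier M\<rbrakk> \<Longrightarrow>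
       (a \<otimes> b) \<odot>\<^bsub>M\<^esub> x = a \<odot>\<^bsub>M\<^esub> (b \<odot>\<^bsub>M\<^esub> x)"
    and smult_one:
      "x \<in> carrier M \<Longrightarrow> \<one> \<odot>\<^bsub>M\<^esub> x = x"

definition submodules :: "('a, 'm) ring_scheme \<Rightarrow> ('a, 'b, 'c) module_scheme \<Rightarrow> 'b set set"
  where "submodules R M = {N. submodule N R M}"

text \<open>
  Distributivity of the lattice of submodules, with meet \<open>\<inter>\<close> and join the sum
  \<open>set_add M\<close> (the library's \<open><+>\<^bsub>M\<^esub>\<close>). The dual distributive law follows from this one in any
  lattice.
\<close>

definition distributive_module ::
    "('a, 'm) ring_scheme \<Rightarrow> ('a, 'b, 'c) module_scheme \<Rightarrow> bool"
  where "distributive_module R M \<longleftrightarrow>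
    (\<forall>A \<in> submodules R M. \<forall>B \<in> submodules R M. \<forall>C \<in> submodules R M.
       A \<inter> set_add M B C = set_add M (A \<inter> B) (A \<inter> C))"

text \<open>
  A composition series is a finite chain of submodules from \<open>0\<close> to \<open>M\<close> in which each term is
  a maximal proper submodule of the next. The zero module has one with \<open>n = 0\<close>.
\<close>

definition composition_series ::
    "('a, 'm) ring_scheme \<Rightarrow> ('a, 'b, 'c) module_scheme \<Rightarrow> nat \<Rightarrow> (nat \<Rightarrow> 'b set) \<Rightarrow> bool"
  where "composition_series R M n S \<longleftrightarrow>
    (\<forall>i\<le>n. S i \<in> submodules R M) \<and>
    S 0 = {\<zero>\<^bsub>M\<^esub>} \<and> S n = carrier M \<and>
    (\<forall>i<n. S i \<subset> S (Suc i) \<and>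
       \<not> (\<exists>N \<in> submodules R M. S i \<subset> N \<and> N \<subset> S (Suc i)))"

definition finite_length :: "('a, 'm) ring_scheme \<Rightarrow> ('a, 'b, 'c) module_scheme \<Rightarrow> bool"
  where "finite_length R M \<longleftrightarrow> (\<exists>n S. composition_series R M n S)"

end

theory Submission
  imports Defs
begin

text \<open>
  Along a composition series \<open>0 = S 0 \<subset> \<dots> \<subset> S n = M\<close> a submodule \<open>N\<close> is determined by the set
  of indices \<open>i\<close> with \<open>N \<inter> S (i + 1) \<subseteq> S i\<close>. Indeed, for two submodules with the same indices one
  shows \<open>N \<inter> S i = N' \<inter> S i\<close> by induction on \<open>i\<close>: the submodules \<open>N \<inter> S (i + 1)\<close> and
  \<open>N' \<inter> S (i + 1)\<close> have the same meet with \<open>S i\<close>, and either both lie in \<open>S i\<close> or, by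
  maximality of \<open>S i\<close>, both have sum \<open>S (i + 1)\<close> with \<open>S i\<close>. In a distributive lattice, complements
  relative to \<open>S i\<close> in this sense are unique. Hence there are at most \<open>2 ^ n\<close> submodules.
\<close>

context left_module
begin

lemma submodulesD:
  assumes "N \<in> submodules R M"
  shows "subgroup N (add_monoid M)" "N \<subseteq> carrier M" "\<zero>\<^bsub>M\<^esub> \<in> N"
    and "\<And>x y. \<lbrakk>x \<in> N; y \<in> N\<rbrakk> \<Longrightarrow> x \<oplus>\<^bsub>M\<^esub> y \<in> N"
    and "\<And>a x. \<lbrakk>a \<in> carrier R; x \<in> N\<rbrakk> \<Longrightarrow> a \<odot>\<^bsub>M\<^esub> x \<in> N"
proof -
  interpret submodule N R M
    using assms by (simp add: submodules_def)
  show "subgroup N (add_monoid M)" by (rule is_subgroup)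
  show "N \<subseteq> carrier M" using subset by simp
  show "\<zero>\<^bsub>M\<^esub> \<in> N" using one_closed by simp
  show "x \<oplus>\<^bsub>M\<^esub> y \<in> N" if "x \<in> N" "y \<in> N" for x y
    using m_closed[OF that] by simp
  show "a \<odot>\<^bsub>M\<^esub> x \<in> N" if "a \<in> carrier R" "x \<in> N" for a x
    using that by (rule smult_closed)
qed

lemma submodules_Int:
  assumes "N \<in> submodules R M" "K \<in> submodules R M"
  shows "N \<inter> K \<in> submodules R M"
  using assms M.add.subgroups_Inter_pair
  by (auto simp: submodules_def submodule_def submodule_axioms_def)

lemma submodules_set_add:
  assumes N: "N \<in> submodules R M" and K: "K \<in> submodules R M"
  shows "N <+>\<^bsub>M\<^esub> K \<in> submodules R M"
proof -
  have "subgroup (N <+>\<^bsub>M\<^esub> K) (add_monoid M)"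
    unfolding set_add_def using submodulesD(1)[OF N] submodulesD(1)[OF K]
    by (rule M.add.mult_subgroups)
  moreover have "a \<odot>\<^bsub>M\<^esub> z \<in> N <+>\<^bsub>M\<^esub> K" if "a \<in> carrier R" "z \<in> N <+>\<^bsub>M\<^esub> K" for a z
  proof -
    from that(2) obtain x y where "x \<in> N" "y \<in> K" "z = x \<oplus>\<^bsub>M\<^esub> y"
      by (auto simp: set_add_def')
    moreover from this have "a \<odot>\<^bsub>M\<^esub> z = a \<odot>\<^bsub>M\<^esub> x \<oplus>\<^bsub>M\<^esub> a \<odot>\<^bsub>M\<^esub> y"
      using smult_r_distr[OF that(1)] submodulesD(2)[OF N] submodulesD(2)[OF K] by blast
    ultimately show ?thesis
      using submodulesD(5)[OF N that(1)] submodulesD(5)[OF K that(1)]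
      unfolding set_add_def' by blast
  qed
  ultimately show ?thesis
    by (simp add: submodules_def submodule_def submodule_axioms_def)
qed

lemma submodules_le_set_add:
  assumes N: "N \<in> submodules R M" and K: "K \<in> submodules R M"
  shows "N \<subseteq> N <+>\<^bsub>M\<^esub> K" "K \<subseteq> N <+>\<^bsub>M\<^esub> K"
proof -
  have "x \<oplus>\<^bsub>M\<^esub> \<zero>\<^bsub>M\<^esub> \<in> N <+>\<^bsub>M\<^esub> K" if "x \<in> N" for x
    using that submodulesD(3)[OF K] by (auto simp: set_add_def')
  then show "N \<subseteq> N <+>\<^bsub>M\<^esub> K"
    using submodulesD(2)[OF N] by (metis M.r_zero subsetD subsetI)
  have "\<zero>\<^bsub>M\<^esub> \<oplus>\<^bsub>M\<^esub> y \<in> N <+>\<^bsub>M\<^esub> K" if "y \<in> K" for y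
    using that submodulesD(3)[OF N] by (auto simp: set_add_def')
  then show "K \<subseteq> N <+>\<^bsub>M\<^esub> K"
    using submodulesD(2)[OF K] by (metis M.l_zero subsetD subsetI)
qed

lemma set_add_submodules_le:
  assumes "N \<subseteq> L" "K \<subseteq> L" "L \<in> submodules R M"
  shows "N <+>\<^bsub>M\<^esub> K \<subseteq> L"
  using assms(1,2) submodulesD(4)[OF assms(3)] by (auto simp: set_add_def')

text \<open>Intersecting \<open>A\<close> with \<open>B <+> C\<close> splits it into
  \<open>A \<inter> B\<close> and \<open>A \<inter> C\<close>, both inside \<open>B\<close>. This is
  the one-sided form of uniqueness of relative complements, and the only place where distributivity
  enters.\<close>

lemma distributive_le:
  assumes "distributive_module R M"
    and "A \<in> submodules R M" "B \<in> submodules R M" "C \<in> submodules R M"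
    and "A \<inter> C \<subseteq> B" "A \<subseteq> B <+>\<^bsub>M\<^esub> C"
  shows "A \<subseteq> B"
proof -
  have "A = A \<inter> (B <+>\<^bsub>M\<^esub> C)" using assms(6) by blast
  also have "\<dots> = (A \<inter> B) <+>\<^bsub>M\<^esub> (A \<inter> C)"
    using assms(1-4) unfolding distributive_module_def by blast
  also have "\<dots> \<subseteq> B"
    using assms(3,5) by (intro set_add_submodules_le) auto
  finally show ?thesis .
qed

lemma composition_seriesD:
  assumes "composition_series R M n S"
  shows "\<And>i. i \<le> n \<Longrightarrow> S i \<in> submodules R M"
    and "S 0 = {\<zero>\<^bsub>M\<^esub>}" "S n = carrier M"
    and "\<And>i. i < n \<Longrightarrow> S i \<subset> S (Suc i)"
    and "\<And>i L. \<lbrakk>i < n; L \<in> submodules R M; S i \<subset> L\<rbrakk> \<Longrightarrow> \<not> L \<subset> S (Suc i)"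
proof -
  note series = assms[unfolded composition_series_def]
  note step = series[THEN conjunct2, THEN conjunct2, THEN conjunct2, rule_format]
  show "S i \<in> submodules R M" if "i \<le> n" for i
    using series[THEN conjunct1] that by blast
  show "S 0 = {\<zero>\<^bsub>M\<^esub>}"
    by (rule series[THEN conjunct2, THEN conjunct1])
  show "S n = carrier M"
    by (rule series[THEN conjunct2, THEN conjunct2, THEN conjunct1])
  show "S i \<subset> S (Suc i)" if "i < n" for i
    using step[OF that] by (rule conjunct1)
  show "\<not> L \<subset> S (Suc i)" if "i < n" "L \<in> submodules R M" "S i \<subset> L" for i L
    using step[OF that(1), THEN conjunct2] that(2,3) by metis
qed

text \<open>Inclusion needs only one implication between the index conditions; equality of
  submodules comes from using the lemma in both directions.\<close>

lemma composition_series_le: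
  assumes dist: "distributive_module R M" and S: "composition_series R M n S"
    and N: "N \<in> submodules R M" and K: "K \<in> submodules R M"
    and indices: "\<And>i. i < n \<Longrightarrow> K \<inter> S (Suc i) \<subseteq> S i \<Longrightarrow> N \<inter> S (Suc i) \<subseteq> S i"
    and "i \<le> n"
  shows "N \<inter> S i \<subseteq> K"
  using \<open>i \<le> n\<close>
proof (induction i)
  case 0
  show ?case
    unfolding composition_seriesD(2)[OF S] using submodulesD(3)[OF K] by blast
next
  case (Suc i)
  then have IH: "N \<inter> S i \<subseteq> K" by simp
  let ?C = "K \<inter> S (Suc i)"
  have "i < n" using Suc.prems by simp
  have Si: "S i \<in> submodules R M" "S (Suc i) \<in> submodules R M"
    using composition_seriesD(1)[OF S] Suc.prems by simp_all
  have mono: "S i \<subseteq> S (Suc i)"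
    using composition_seriesD(4)[OF S \<open>i < n\<close>] by blast
  have C: "?C \<in> submodules R M"
    using K Si by (simp add: submodules_Int)
  show ?case
  proof (cases "?C \<subseteq> S i")
    case True
    \<comment> \<open>Here \<open>N \<inter> S (Suc i)\<close> also lies in \<open>S i\<close>, so
      it is contained in \<open>N \<inter> S i\<close>.\<close>
    then show ?thesis using indices[OF \<open>i < n\<close>] IH by blast
  next
    case False
    \<comment> \<open>The sum is a submodule strictly above \<open>S i\<close> and inside
      \<open>S (Suc i)\<close>, so maximality of \<open>S i\<close> forces equality.\<close>
    have "S i \<subset> ?C <+>\<^bsub>M\<^esub> S i"
      using submodules_le_set_add[OF C Si(1)] False by blast
    moreover have "?C <+>\<^bsub>M\<^esub> S i \<subseteq> S (Suc i)"
      using mono Si by (intro set_add_submodules_le) auto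
    ultimately have sum: "?C <+>\<^bsub>M\<^esub> S i = S (Suc i)"
      using composition_seriesD(5)[OF S \<open>i < n\<close> submodules_set_add[OF C Si(1)]] by blast
    \<comment> \<open>Cancel \<open>S i\<close>: the meet condition is the induction hypothesis, and
      the join condition holds because \<open>?C\<close> and \<open>S i\<close> sum to all of
      \<open>S (Suc i)\<close>.\<close>
    have "N \<inter> S (Suc i) \<subseteq> ?C"
    proof (rule distributive_le[OF dist _ C Si(1)])
      show "N \<inter> S (Suc i) \<in> submodules R M"
        using N Si by (simp add: submodules_Int)
    qed (use sum mono IH in blast)+
    then show ?thesis by blast
  qed
qed

end

theorem corollary15:
  fixes R :: "('a, 'm) ring_scheme"
    and M :: "('a, 'b, 'c) module_scheme"
  assumes "left_module R M"
    and "distributive_module R M"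
    and "finite_length R M"
  shows "finite (submodules R M)"
proof -
  interpret left_module R M by fact
  obtain n S where S: "composition_series R M n S"
    using assms(3) unfolding finite_length_def by blast
  \<comment> \<open>\<open>J N\<close> collects the steps at which \<open>N \<inter> S i\<close>
    does not grow, that is, where \<open>N \<inter> S (Suc i)\<close> has zero image in the simple
    factor.\<close>
  define J where "J N = {i. i < n \<and> N \<inter> S (Suc i) \<subseteq> S i}" for N
  have le: "N \<subseteq> K" if "N \<in> submodules R M" "K \<in> submodules R M" "J N = J K" for N K
  proof -
    have "N \<inter> S (Suc i) \<subseteq> S i" if "i < n" "K \<inter> S (Suc i) \<subseteq> S i" for i
      using that \<open>J N = J K\<close> unfolding J_def by blast
    then have "N \<inter> S n \<subseteq> K"
      by (rule composition_series_le[OF assms(2) S that(1,2)]) simp_all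
    moreover have "N \<subseteq> S n"
      using composition_seriesD(3)[OF S] submodulesD(2)[OF that(1)] by blast
    ultimately show ?thesis by blast
  qed
  have "inj_on J (submodules R M)"
    \<comment> \<open>The hypothesis \<open>J N = J K\<close> is symmetric, so \<open>le\<close>
      gives both inclusions.\<close>
    by (intro inj_onI equalityI le) auto
  moreover have "J ` submodules R M \<subseteq> Pow {..<n}"
    by (auto simp: J_def)
  ultimately show ?thesis
    by (meson finite_Pow_iff finite_lessThan inj_on_finite)
qed

end
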